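(* Let $\mathcal H$ be a real Hilbert space and let $A:\mathcal H\to 2^{\mathcal H}$ be paramonotone and maximally monotone. Then the following are equivalent: (i) $A$ is strictly monotone. (ii) $A$ is almost strictly monotone. (iii) $A^{-1}$ is at most single-valued. (iv) $J_A$ is strictly nonexpansive, i.e., $\|J_Ax-J_Ay\|<\|x-y\|$ for all $x,y\in\mathcal H$ with $x\neq y$. (v) $\operatorname{Id}-J_A$ is injective. (vi) $\operatorname{Id}-J_A$ is strictly monotone.
   Context: For a set-valued operator $A:\mathcal H\to2^{\mathcal H}$: $\operatorname{gra}A=\{(x,v):v\in Ax\}$, $\operatorname{dom}A=\{x:Ax\ne\varnothing\}$, $A^{-1}$ is the set-valued inverse, with $\operatorname{gra}A^{-1}=\{(v,x):(x,v)\in\operatorname{gra}A\}$, and $J_A=(\operatorname{Id}+A)^{-1}$ is the resolvent (for maximally monotone $A$ it is a single-valued map defined on all of $\mathcal H$). $A$ is monotone if $\langle x_0-x_1,v_0-v_1\rangle\ge0$ for all $(x_i,v_i)\in\operatorname{gra}A$; maximally monotone if it is monotone and its graph is not properly contained in the graph of another monotone operator; strictly monotone if $\langle x_0-x_1,v_0-v_1\rangle>0$ whenever $(x_i,v_i)\in\operatorname{gra}A$ ($i=0,1$) and $x_0\ne x_1$; almost strictly monotone if it is monotone and is strictly monotone on every line segment contained in $\operatorname{dom}A$ (i.e. whenever $[y_0,y_1]\subseteq\operatorname{dom}A$, the strict inequality holds for all $(x_i,v_i)\in\operatorname{gra}A$ with $x_0\neq x_1$ in $[y_0,y_1]$); paramonotone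 if it is monotone and, for all $(x_0,v_0),(x_1,v_1)\in\operatorname{gra}A$, $\langle x_0-x_1,v_0-v_1\rangle=0$ implies $(x_0,v_1)\in\operatorname{gra}A$ and $(x_1,v_0)\in\operatorname{gra}A$. An operator is at most single-valued if its value at every point is either empty or a singleton. *)

theory Defs
  imports "HOL-Analysis.Analysis"
begin

text \<open>A set-valued operator on a space is a function \<open>'a \<Rightarrow> 'a set\<close>.
  Real Hilbert spaces are types of sort \<open>{real_inner, complete_space}\<close>.\<close>

definition op_graph :: "('a \<Rightarrow> 'a set) \<Rightarrow> ('a \<times> 'a) set" where
  "op_graph A = {(x, v). v \<in> A x}"

definition op_domain :: "('a \<Rightarrow> 'a set) \<Rightarrow> 'a set" where
  "op_domain A = {x. A x \<noteq> {}}"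

definition op_inverse :: "('a \<Rightarrow> 'a set) \<Rightarrow> 'a \<Rightarrow> 'a set" where
  "op_inverse A v = {x. (x, v) \<in> op_graph A}"

definition at_most_single_valued :: "('a \<Rightarrow> 'a set) \<Rightarrow> bool" where
  "at_most_single_valued A \<longleftrightarrow> (\<forall>x. A x = {} \<or> (\<exists>v. A x = {v}))"

definition monotone_op :: "('a::real_inner \<Rightarrow> 'a set) \<Rightarrow> bool" where
  "monotone_op A \<longleftrightarrow>
     (\<forall>(x0, v0) \<in> op_graph A. \<forall>(x1, v1) \<in> op_graph A. (x0 - x1) \<bullet> (v0 - v1) \<ge> 0)"

definition maximally_monotone_op :: "('a::real_inner \<Rightarrow> 'a set) \<Rightarrow> bool" where
  "maximally_monotone_op A \<longleftrightarrow>
     monotone_op A \<and> (\<forall>B. monotone_op B \<longrightarrow> \<not> op_graph A \<subset> op_graph B)"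

definition strictly_monotone_op :: "('a::real_inner \<Rightarrow> 'a set) \<Rightarrow> bool" where
  "strictly_monotone_op A \<longleftrightarrow>
     (\<forall>(x0, v0) \<in> op_graph A. \<forall>(x1, v1) \<in> op_graph A.
        x0 \<noteq> x1 \<longrightarrow> (x0 - x1) \<bullet> (v0 - v1) > 0)"

definition almost_strictly_monotone_op :: "('a::real_inner \<Rightarrow> 'a set) \<Rightarrow> bool" where
  "almost_strictly_monotone_op A \<longleftrightarrow>
     monotone_op A \<and>
     (\<forall>y0 y1. closed_segment y0 y1 \<subseteq> op_domain A \<longrightarrow>
        (\<forall>(x0, v0) \<in> op_graph A. \<forall>(x1, v1) \<in> op_graph A.
           x0 \<in> closed_segment y0 y1 \<and> x1 \<in> closed_segment y0 y1 \<and> x0 \<noteq> x1 \<longrightarrow>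
           (x0 - x1) \<bullet> (v0 - v1) > 0))"

definition paramonotone_op :: "('a::real_inner \<Rightarrow> 'a set) \<Rightarrow> bool" where
  "paramonotone_op A \<longleftrightarrow>
     monotone_op A \<and>
     (\<forall>(x0, v0) \<in> op_graph A. \<forall>(x1, v1) \<in> op_graph A.
        (x0 - x1) \<bullet> (v0 - v1) = 0 \<longrightarrow> (x0, v1) \<in> op_graph A \<and> (x1, v0) \<in> op_graph A)"

definition resolvent_op :: "('a::real_inner \<Rightarrow> 'a set) \<Rightarrow> 'a \<Rightarrow> 'a set" where
  "resolvent_op A = op_inverse (\<lambda>x. {x + v | v. v \<in> A x})"

text \<open>The resolvent as a map. The value \<open>the_elem S\<close> is unspecified unless \<open>S\<close> is a
  singleton; for maximally monotone operators on a Hilbert space every \<open>resolvent_op A x\<close>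
  is a singleton by Minty's theorem.\<close>

definition resolvent :: "('a::real_inner \<Rightarrow> 'a set) \<Rightarrow> 'a \<Rightarrow> 'a" where
  "resolvent A x = the_elem (resolvent_op A x)"

definition strictly_nonexpansive :: "('a::real_inner \<Rightarrow> 'a) \<Rightarrow> bool" where
  "strictly_nonexpansive T \<longleftrightarrow> (\<forall>x y. x \<noteq> y \<longrightarrow> norm (T x - T y) < norm (x - y))"

end

theory Submission
  imports Defs
begin

text \<open>Every condition is equivalent to (iii). The equivalence with (ii) uses that the values of
  \<open>A\<inverse>\<close> are convex, and the ones involving the resolvent use Minty's theorem.

  For Minty's theorem, \<open>x\<close> lies in the resolvent of \<open>w\<close> iff \<open>(x - y) \<bullet> (x - (w - v)) \<le> 0\<close> for all
  \<open>(y, v)\<close> in the graph, by maximality. With \<open>z = (y + (w - v)) / 2\<close> and \<open>c = y \<bullet> (w - v)\<close> this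
  reads \<open>\<parallel>x\<parallel>\<^sup>2 - 2 (x \<bullet> z) + c \<le> 0\<close>. On the convex hull of the points \<open>(z, c)\<close>, monotonicity gives
  \<open>c - \<parallel>z\<parallel>\<^sup>2 \<le> 0\<close>; this function is strongly concave in \<open>z\<close>, so the \<open>z\<close>-components of any maximizing
  sequence form a Cauchy sequence. The first-order optimality condition at the limit \<open>x\<close> is the
  required inequality.\<close>

text \<open>The conclusion puts \<open>P\<close> below the tangent hyperplane c = 2 (x \<bullet> z)
  - |x|^2 of the paraboloid c = |z|^2. The point of tangency lies above the limit of the
  z-components of points of \<open>P\<close> whose vertical gap to the paraboloid tends to its
  infimum, which is -\<open>S\<close>.\<close>

lemma convex_dominated_by_norm_sq_tangent:
  fixes P :: "('a::{real_inner, complete_space} \<times> real) set"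
  assumes "convex P" and below: "\<And>z c. (z, c) \<in> P \<Longrightarrow> c \<le> (norm z)\<^sup>2"
  obtains x where "\<And>z c. (z, c) \<in> P \<Longrightarrow> (norm x)\<^sup>2 - 2 * (x \<bullet> z) + c \<le> 0"
proof (cases "P = {}")
  case True
  then show ?thesis using that by blast
next
  case False
  define D where "D p = snd p - (norm (fst p))\<^sup>2" for p :: "'a \<times> real"
  define S where "S = (SUP p\<in>P. D p)"
  have D0: "D p \<le> 0" if "p \<in> P" for p
    using below[of "fst p" "snd p"] that by (simp add: D_def)
  then have bdd: "bdd_above (D ` P)" by (rule bdd_aboveI2)
  have DS: "D p \<le> S" if "p \<in> P" for p
    unfolding S_def using that bdd by (rule cSUP_upper)
  have S0: "S \<le> 0" unfolding S_def using False D0 by (rule cSUP_least)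
  have "\<exists>p\<in>P. S - inverse (real (Suc n)) < D p" for n
    using less_cSUP_iff[OF False bdd, of "S - inverse (real (Suc n))"] unfolding S_def by simp
  then obtain p where pP: "\<And>n. p n \<in> P" and pD: "\<And>n. S - inverse (real (Suc n)) < D (p n)"
    by metis
  define z where "z n = fst (p n)" for n
  define c where "c n = snd (p n)" for n
  have dist_sq: "(norm (z m - z n))\<^sup>2 \<le> 2 * inverse (real (Suc m)) + 2 * inverse (real (Suc n))" for m n
  proof -
    let ?q = "(1/2) *\<^sub>R p m + (1/2) *\<^sub>R p n"
    have "?q \<in> P" using convexD[OF \<open>convex P\<close> pP pP, of "1/2" "1/2"] by simp
    then have "D ?q \<le> S" by (rule DS)
    \<comment> \<open>Parallelogram identity: at the midpoint \<open>D\<close> exceeds the mean of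
      the two values by a quarter of the squared distance, while both values are already close to
      the supremum.\<close>
    moreover have "D ?q = (D (p m) + D (p n)) / 2 + (norm (z m - z n))\<^sup>2 / 4"
      unfolding D_def z_def
      by (simp add: power2_norm_eq_inner inner_simps inner_commute, simp add: field_simps)
    ultimately show ?thesis using pD[of m] pD[of n] by argo
  qed
  have "Cauchy z"
  proof (rule metric_CauchyI)
    fix e :: real assume "0 < e"
    then obtain N where N: "inverse (real (Suc N)) < e\<^sup>2 / 4"
      using reals_Archimedean[of "e\<^sup>2 / 4"] by auto
    have "dist (z m) (z n) < e" if "m \<ge> N" "n \<ge> N" for m n
    proof -
      have "inverse (real (Suc m)) \<le> inverse (real (Suc N))"
        "inverse (real (Suc n)) \<le> inverse (real (Suc N))"
        using that by (simp_all add: le_imp_inverse_le)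
      then have "(norm (z m - z n))\<^sup>2 < e\<^sup>2" using dist_sq[of m n] N by linarith
      then show ?thesis using \<open>0 < e\<close> by (simp add: dist_norm power2_less_imp_less)
    qed
    then show "\<exists>N. \<forall>m\<ge>N. \<forall>n\<ge>N. dist (z m) (z n) < e" by blast
  qed
  then obtain x where zx: "z \<longlonglongrightarrow> x" using Cauchy_convergent convergentD by blast
  have "(\<lambda>n. S - inverse (real (Suc n))) \<longlonglongrightarrow> S - 0"
    by (intro tendsto_intros LIMSEQ_inverse_real_of_nat)
  then have low: "(\<lambda>n. S - inverse (real (Suc n))) \<longlonglongrightarrow> S" by simp
  have "(\<lambda>n. D (p n)) \<longlonglongrightarrow> S"
    by (rule tendsto_sandwich[OF _ _ low tendsto_const])
      (use pD DS[OF pP] in \<open>simp_all add: less_imp_le del: of_nat_Suc\<close>)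
  then have "(\<lambda>n. D (p n) + (norm (z n))\<^sup>2) \<longlonglongrightarrow> S + (norm x)\<^sup>2"
    by (intro tendsto_intros zx)
  then have cx: "c \<longlonglongrightarrow> S + (norm x)\<^sup>2" by (simp add: D_def c_def[abs_def] z_def)
  have "(norm x)\<^sup>2 - 2 * (x \<bullet> z') + c' \<le> 0" if q: "(z', c') \<in> P" for z' c'
  proof -
    \<comment> \<open>The limit point (x, S + |x|^2) need not lie in \<open>P\<close>. So
      \<open>D\<close> \<le> \<open>S\<close> is used on the segment from \<open>p n\<close> to the
      given point; only then does n tend to infinity, and division by t follows. Letting t tend to 0
      leaves the bound \<open>S\<close>, which is at most 0.\<close>
    have perturb: "(norm x)\<^sup>2 - 2 * (x \<bullet> z') + c' \<le> S + t * (norm (z' - x))\<^sup>2"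
      if t: "0 < t" "t \<le> 1" for t
    proof -
      have "((1 - t) * c n + t * c') - (norm ((1 - t) *\<^sub>R z n + t *\<^sub>R z'))\<^sup>2 \<le> S" for n
      proof -
        have "(1 - t) *\<^sub>R p n + t *\<^sub>R (z', c') \<in> P"
          using t by (intro convexD[OF \<open>convex P\<close> pP q]) auto
        from DS[OF this] show ?thesis by (simp add: D_def z_def c_def)
      qed
      moreover have "(\<lambda>n. ((1 - t) * c n + t * c') - (norm ((1 - t) *\<^sub>R z n + t *\<^sub>R z'))\<^sup>2)
          \<longlonglongrightarrow> ((1 - t) * (S + (norm x)\<^sup>2) + t * c') - (norm ((1 - t) *\<^sub>R x + t *\<^sub>R z'))\<^sup>2"
        by (intro tendsto_intros zx cx)
      ultimately have "((1 - t) * (S + (norm x)\<^sup>2) + t * c')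
          - (norm ((1 - t) *\<^sub>R x + t *\<^sub>R z'))\<^sup>2 \<le> S"
        by (intro LIMSEQ_le_const2) auto
      then have "t * ((norm x)\<^sup>2 - 2 * (x \<bullet> z') + c') \<le> t * (S + t * (norm (z' - x))\<^sup>2)"
        by (simp add: power2_norm_eq_inner algebra_simps inner_commute)
      then show ?thesis using t by simp
    qed
    have "((\<lambda>t. S + t * (norm (z' - x))\<^sup>2) \<longlongrightarrow> S + 0 * (norm (z' - x))\<^sup>2) (at_right 0)"
      by (intro tendsto_intros)
    moreover have "\<forall>\<^sub>F t in at_right 0. (norm x)\<^sup>2 - 2 * (x \<bullet> z') + c' \<le> S + t * (norm (z' - x))\<^sup>2"
      unfolding eventually_at_right_field using perturb by (intro exI[of _ 1]) auto
    ultimately have "(norm x)\<^sup>2 - 2 * (x \<bullet> z') + c' \<le> S + 0 * (norm (z' - x))\<^sup>2"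
      by (intro tendsto_lowerbound) auto
    then show ?thesis using S0 by simp
  qed
  then show ?thesis using that by blast
qed

text \<open>The inequality for (a, b) says that x lies in the closed ball with diameter [a, b], so
  these balls have a common point. Expanded, it is the tangent inequality at z = (a + b)/2 and c = a
  \<bullet> b. The hull is taken of the triples, since a and b are both needed to keep c \<le> a
  \<bullet> b.\<close>

lemma antitone_pairs_common_point:
  fixes G :: "('a::{real_inner, complete_space} \<times> 'a) set"
  assumes anti: "\<And>a b a' b'. (a, b) \<in> G \<Longrightarrow> (a', b') \<in> G \<Longrightarrow> (a - a') \<bullet> (b - b') \<le> 0"
  obtains x where "\<And>a b. (a, b) \<in> G \<Longrightarrow> (x - a) \<bullet> (x - b) \<le> 0"
proof -
  define H where "H = convex hull ((\<lambda>(a, b). (a, b, a \<bullet> b)) ` G)"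
  define L :: "'a \<times> 'a \<times> real \<Rightarrow> 'a \<times> real" where "L = (\<lambda>(a, b, c). ((1/2) *\<^sub>R (a + b), c))"
  \<comment> \<open>The set of \<open>(a, b, c)\<close> with \<open>c \<le> a \<bullet> b\<close> is not convex, but its polarization is
    affine in each argument.\<close>
  have half: "convex {(a, b, c). c + c' \<le> a \<bullet> b' + a' \<bullet> b}" for a' b' :: 'a and c' :: real
  proof (rule convexI)
    fix p q :: "'a \<times> 'a \<times> real" and u v :: real
    assume p: "p \<in> {(a, b, c). c + c' \<le> a \<bullet> b' + a' \<bullet> b}"
      and q: "q \<in> {(a, b, c). c + c' \<le> a \<bullet> b' + a' \<bullet> b}"
      and uv: "0 \<le> u" "0 \<le> v" "u + v = 1"
    obtain a b c where p': "p = (a, b, c)" by (cases p)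
    obtain a2 b2 c2 where q': "q = (a2, b2, c2)" by (cases q)
    have "u * (c + c') + v * (c2 + c') \<le> u * (a \<bullet> b' + a' \<bullet> b) + v * (a2 \<bullet> b' + a' \<bullet> b2)"
      using p q uv unfolding p' q' by (intro add_mono[OF mult_left_mono mult_left_mono]) auto
    moreover have "u * c' + v * c' = c'" using uv by (metis distrib_right mult_1)
    ultimately show "u *\<^sub>R p + v *\<^sub>R q \<in> {(a, b, c). c + c' \<le> a \<bullet> b' + a' \<bullet> b}"
      unfolding p' q' by (simp add: algebra_simps)
  qed
  \<comment> \<open>The polarized inequality passes to the hull one argument at a time: first with
    the other argument in \<open>G\<close>, then with it in \<open>H\<close>. On the diagonal it
    reads 2 c \<le> 2 (a \<bullet> b).\<close>
  have 1: "H \<subseteq> {(a, b, c). c + a' \<bullet> b' \<le> a \<bullet> b' + a' \<bullet> b}" if "(a', b') \<in> G" for a' b'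
    unfolding H_def
  proof (rule hull_minimal)
    show "(\<lambda>(a, b). (a, b, a \<bullet> b)) ` G \<subseteq> {(a, b, c). c + a' \<bullet> b' \<le> a \<bullet> b' + a' \<bullet> b}"
      using anti[OF _ that] by (auto simp: algebra_simps)
  qed (rule half)
  have 2: "H \<subseteq> {(a, b, c). c + c' \<le> a \<bullet> b' + a' \<bullet> b}" if "(a', b', c') \<in> H" for a' b' c'
    unfolding H_def
  proof (rule hull_minimal)
    show "(\<lambda>(a, b). (a, b, a \<bullet> b)) ` G \<subseteq> {(a, b, c). c + c' \<le> a \<bullet> b' + a' \<bullet> b}"
      using 1 that by (fastforce simp: inner_commute algebra_simps)
  qed (rule half)
  have hull: "c \<le> a \<bullet> b" if "(a, b, c) \<in> H" for a b c
    using 2[OF that] that by auto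
  have "linear L"
    unfolding L_def by (rule linearI) (auto simp: algebra_simps)
  then have "convex (L ` H)"
    unfolding H_def by (rule convex_linear_image) (rule convex_convex_hull)
  moreover have "c \<le> (norm z)\<^sup>2" if LH: "(z, c) \<in> L ` H" for z c
  proof -
    obtain a b where ab: "(a, b, c) \<in> H" "z = (1/2) *\<^sub>R (a + b)"
      using LH unfolding L_def by auto
    have "(norm z)\<^sup>2 - a \<bullet> b = (norm ((1/2) *\<^sub>R (a - b)))\<^sup>2"
      unfolding ab by (simp only: power2_norm_eq_inner) (simp add: algebra_simps inner_commute)
    then have "a \<bullet> b \<le> (norm z)\<^sup>2" by (metis diff_ge_0_iff_ge zero_le_power2)
    with hull[OF ab(1)] show ?thesis by linarith
  qed
  ultimately obtain x where x: "\<And>z c. (z, c) \<in> L ` H \<Longrightarrow> (norm x)\<^sup>2 - 2 * (x \<bullet> z) + c \<le> 0"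
    using convex_dominated_by_norm_sq_tangent[of "L ` H"] by blast
  have "(x - a) \<bullet> (x - b) \<le> 0" if "(a, b) \<in> G" for a b
  proof -
    have "(a, b, a \<bullet> b) \<in> H" unfolding H_def using that by (intro hull_inc) force
    then have "L (a, b, a \<bullet> b) \<in> L ` H" by (rule imageI)
    then have "((1/2) *\<^sub>R (a + b), a \<bullet> b) \<in> L ` H" by (simp add: L_def)
    from x[OF this] show ?thesis
      by (simp add: power2_norm_eq_inner algebra_simps inner_commute)
  qed
  then show ?thesis using that by blast
qed

lemma monotone_opD:
  assumes "monotone_op A" "v \<in> A x" "w \<in> A y"
  shows "0 \<le> (x - y) \<bullet> (v - w)"
  using assms unfolding monotone_op_def op_graph_def by blast

lemma paramonotone_opD:
  assumes "paramonotone_op A" "v \<in> A x" "w \<in> A y" "(x - y) \<bullet> (v - w) = 0"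
  shows "w \<in> A x"
  using assms unfolding paramonotone_op_def op_graph_def by blast

text \<open>Adjoining (x, u) to the graph keeps it monotone, so by maximality the pair belongs to it
  already.\<close>

lemma maximally_monotone_op_memI:
  assumes max: "maximally_monotone_op A"
    and rel: "\<And>y v. v \<in> A y \<Longrightarrow> 0 \<le> (x - y) \<bullet> (u - v)"
  shows "u \<in> A x"
proof (rule ccontr)
  assume "u \<notin> A x"
  define B where "B y = (if y = x then insert u (A y) else A y)" for y
  have graph: "op_graph B = insert (x, u) (op_graph A)"
    unfolding op_graph_def B_def by (auto split: if_splits)
  have sym: "0 \<le> (y - x) \<bullet> (v - u)" if "v \<in> A y" for y v
    using rel[OF that] by (metis inner_minus_left inner_minus_right minus_diff_eq)
  have mono: "monotone_op A" using max by (simp add: maximally_monotone_op_def)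
  have "monotone_op B"
    unfolding monotone_op_def graph
    using rel sym monotone_opD[OF mono] by (auto simp: op_graph_def)
  moreover have "op_graph A \<subset> op_graph B"
    unfolding graph using \<open>u \<notin> A x\<close> by (auto simp: op_graph_def)
  ultimately show False using max unfolding maximally_monotone_op_def by blast
qed

lemma mem_resolvent_op_iff: "x \<in> resolvent_op A w \<longleftrightarrow> w - x \<in> A x"
  unfolding resolvent_op_def op_inverse_def op_graph_def
  by (auto simp: algebra_simps intro!: exI[of _ "w - x"])

text \<open>Injectivity of Id + A, the uniqueness half of Minty's theorem: here v - w = -(x - y), so
  monotonicity gives -|x - y|^2 \<ge> 0.\<close>

lemma monotone_op_add_eqD:
  assumes "monotone_op A" "v \<in> A x" "w \<in> A y" "x + v = y + w"
  shows "x = y"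
proof -
  have "v - w = - (x - y)" using assms(4) by (simp add: algebra_simps)
  then have "0 \<le> - ((x - y) \<bullet> (x - y))"
    using monotone_opD[OF assms(1-3)] by (metis inner_minus_right)
  then show ?thesis by (metis eq_iff_diff_eq_0 inner_gt_zero_iff neg_0_le_iff_le not_less)
qed

theorem Minty:
  fixes A :: "'a::{real_inner, complete_space} \<Rightarrow> 'a set"
  assumes max: "maximally_monotone_op A"
  shows "resolvent_op A w = {resolvent A w}"
proof -
  have mono: "monotone_op A" using max by (simp add: maximally_monotone_op_def)
  \<comment> \<open>Reflecting values by v \<mapsto> w - v turns monotone pairs into antitone
    ones.\<close>
  define G where "G = {(y, w - v) | y v. v \<in> A y}"
  have "(a - a') \<bullet> (b - b') \<le> 0" if G: "(a, b) \<in> G" "(a', b') \<in> G" for a b a' b'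
  proof -
    obtain v v' where v: "b = w - v" "v \<in> A a" "b' = w - v'" "v' \<in> A a'"
      using G unfolding G_def by blast
    then have "b - b' = - (v - v')" by simp
    then show ?thesis using monotone_opD[OF mono v(2,4)] by (metis inner_minus_right neg_le_0_iff_le)
  qed
  then obtain x where x: "\<And>a b. (a, b) \<in> G \<Longrightarrow> (x - a) \<bullet> (x - b) \<le> 0"
    using antitone_pairs_common_point[of G] by blast
  have "w - x \<in> A x"
  proof (rule maximally_monotone_op_memI[OF max])
    fix y v assume "v \<in> A y"
    then have "(x - y) \<bullet> (x - (w - v)) \<le> 0" by (intro x) (auto simp: G_def)
    then show "0 \<le> (x - y) \<bullet> (w - x - v)" by (simp add: algebra_simps)
  qed
  moreover have "x' = x" if "w - x' \<in> A x'" for x'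
    by (rule monotone_op_add_eqD[OF mono that \<open>w - x \<in> A x\<close>]) simp
  ultimately have "resolvent_op A w = {x}"
    unfolding set_eq_iff mem_resolvent_op_iff singleton_iff by metis
  then show ?thesis by (simp add: resolvent_def)
qed

text \<open>For fixed u and (y, v) the membership inequality is affine in x, so the points whose
  value contains u form an intersection of half-spaces.\<close>

lemma maximally_monotone_op_convex_inverse:
  assumes max: "maximally_monotone_op A" and "u \<in> A x0" "u \<in> A x1" "x \<in> closed_segment x0 x1"
  shows "u \<in> A x"
proof (rule maximally_monotone_op_memI[OF max])
  fix y v assume "v \<in> A y"
  have mono: "monotone_op A" using max by (simp add: maximally_monotone_op_def)
  obtain t where t: "0 \<le> t" "t \<le> 1" "x = (1 - t) *\<^sub>R x0 + t *\<^sub>R x1"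
    using assms(4) by (auto simp: in_segment)
  have "0 \<le> (1 - t) * ((x0 - y) \<bullet> (u - v)) + t * ((x1 - y) \<bullet> (u - v))"
    using t monotone_opD[OF mono _ \<open>v \<in> A y\<close>] assms(2,3) by simp
  also have "\<dots> = (x - y) \<bullet> (u - v)" unfolding t(3) by (simp add: algebra_simps)
  finally show "0 \<le> (x - y) \<bullet> (u - v)" .
qed

lemma at_most_single_valued_inverse_iff:
  "at_most_single_valued (op_inverse A) \<longleftrightarrow> (\<forall>u x y. u \<in> A x \<longrightarrow> u \<in> A y \<longrightarrow> x = y)"
proof -
  have *: "S = {} \<or> (\<exists>s. S = {s}) \<longleftrightarrow> (\<forall>x\<in>S. \<forall>y\<in>S. x = y)" for S :: "'a set"
    by (metis empty_iff insertI1 singletonD subsetI subset_singletonD)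
  show ?thesis
    unfolding at_most_single_valued_def * op_inverse_def op_graph_def Ball_def
      mem_Collect_eq case_prod_conv by blast
qed

theorem theorem6p6:
  fixes A :: "'a::{real_inner, complete_space} \<Rightarrow> 'a set"
  assumes "paramonotone_op A"
    and "maximally_monotone_op A"
  shows "(strictly_monotone_op A \<longleftrightarrow> almost_strictly_monotone_op A)
       \<and> (strictly_monotone_op A \<longleftrightarrow> at_most_single_valued (op_inverse A))
       \<and> (strictly_monotone_op A \<longleftrightarrow> strictly_nonexpansive (resolvent A))
       \<and> (strictly_monotone_op A \<longleftrightarrow> inj (\<lambda>x. x - resolvent A x))
       \<and> (strictly_monotone_op A \<longleftrightarrow> strictly_monotone_op (\<lambda>x. {x - resolvent A x}))"
proof -
  let ?J = "resolvent A" and ?N = "\<lambda>x. x - resolvent A x"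
  note max = assms(2)
  have mono: "monotone_op A" using max by (simp add: maximally_monotone_op_def)
  \<comment> \<open>Minty parametrization: x \<mapsto> (J x, x - J x) runs through the graph of
    \<open>A\<close>, and by \<open>J_add\<close> every graph point (x, u) arises, namely from x +
    u.\<close>
  have N: "?N x \<in> A (?J x)" for x
    using Minty[OF max] mem_resolvent_op_iff by blast
  have J_add: "?J (x + u) = x" if "u \<in> A x" for x u
    using Minty[OF max, of "x + u"] mem_resolvent_op_iff[of x A "x + u"] that by auto
  have JN: "0 \<le> (?J x - ?J y) \<bullet> (?N x - ?N y)" for x y
    by (rule monotone_opD[OF mono N N])
  have split: "x - y = (?J x - ?J y) + (?N x - ?N y)" for x y by simp

  have i_ii: "almost_strictly_monotone_op A" if "strictly_monotone_op A"
    using that mono unfolding strictly_monotone_op_def almost_strictly_monotone_op_def by blast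
  have ii_iii: "at_most_single_valued (op_inverse A)" if asm: "almost_strictly_monotone_op A"
    unfolding at_most_single_valued_inverse_iff
  proof (intro allI impI, rule ccontr)
    fix u x y assume u: "u \<in> A x" "u \<in> A y" and "x \<noteq> y"
    \<comment> \<open>The whole segment lies in the convex preimage of u, hence in the domain, so
      strictness applies to its endpoints with the common value u.\<close>
    have "closed_segment x y \<subseteq> op_domain A"
      using maximally_monotone_op_convex_inverse[OF max u] by (auto simp: op_domain_def)
    moreover have "(x, u) \<in> op_graph A" "(y, u) \<in> op_graph A"
      using u by (simp_all add: op_graph_def)
    ultimately have "0 < (x - y) \<bullet> (u - u)"
      using asm \<open>x \<noteq> y\<close> unfolding almost_strictly_monotone_op_def by fastforce
    then show False by simp
  qed
  have iii_i: "strictly_monotone_op A" if inv: "at_most_single_valued (op_inverse A)"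
  proof -
    have "0 < (x - y) \<bullet> (v - w)" if "v \<in> A x" "w \<in> A y" "x \<noteq> y" for x y v w
    proof -
      \<comment> \<open>If the product vanished, paramonotonicity would put w in both
        \<open>A x\<close> and \<open>A y\<close>, against the injectivity expressed by
        \<open>inv\<close>.\<close>
      have "(x - y) \<bullet> (v - w) \<noteq> 0"
        using paramonotone_opD[OF assms(1) that(1,2)] inv that
        unfolding at_most_single_valued_inverse_iff by blast
      with monotone_opD[OF mono that(1,2)] show ?thesis by simp
    qed
    then show ?thesis unfolding strictly_monotone_op_def op_graph_def by blast
  qed
  have iii_iv: "strictly_nonexpansive ?J" if inv: "at_most_single_valued (op_inverse A)"
    unfolding strictly_nonexpansive_def
  proof (intro allI impI)
    fix x y :: 'a assume "x \<noteq> y"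
    have "?N x \<noteq> ?N y"
    proof
      assume eq: "?N x = ?N y"
      then have "?J x = ?J y"
        using N[of x] N[of y] inv unfolding at_most_single_valued_inverse_iff by metis
      with eq \<open>x \<noteq> y\<close> show False by simp
    qed
    then have "0 < (norm (?N x - ?N y))\<^sup>2" by simp
    \<comment> \<open>Since the cross term is nonnegative by \<open>JN\<close>, |x - y|^2 exceeds |J
      x - J y|^2 by at least the squared increment of Id - J, which is positive.\<close>
    moreover have "(norm (x - y))\<^sup>2 = (norm (?J x - ?J y))\<^sup>2 + (norm (?N x - ?N y))\<^sup>2
        + 2 * ((?J x - ?J y) \<bullet> (?N x - ?N y))"
      unfolding split[of x y] power2_norm_eq_inner inner_add_left inner_add_right
      by (simp add: inner_commute)
    ultimately have "(norm (?J x - ?J y))\<^sup>2 < (norm (x - y))\<^sup>2" using JN[of x y] by linarith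
    then show "norm (?J x - ?J y) < norm (x - y)" by (rule power2_less_imp_less) simp
  qed
  have iv_v: "inj ?N" if asm: "strictly_nonexpansive ?J"
  proof (rule injI, rule ccontr)
    fix x y assume "?N x = ?N y" "x \<noteq> y"
    then have "?J x - ?J y = x - y" by (simp add: algebra_simps)
    with asm \<open>x \<noteq> y\<close> show False unfolding strictly_nonexpansive_def by force
  qed
  have v_iii: "at_most_single_valued (op_inverse A)" if "inj ?N"
    unfolding at_most_single_valued_inverse_iff
  proof (intro allI impI)
    fix u x y assume "u \<in> A x" "u \<in> A y"
    \<comment> \<open>Both sides equal u.\<close>
    then have "?N (x + u) = ?N (y + u)" by (simp add: J_add)
    with \<open>inj ?N\<close> have "x + u = y + u" by (rule injD)
    then show "x = y" by simp
  qed
  have v_vi: "strictly_monotone_op (\<lambda>x. {?N x})" if "inj ?N"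
  proof -
    have "0 < (x - y) \<bullet> (?N x - ?N y)" if "x \<noteq> y" for x y
    proof -
      have "?N x \<noteq> ?N y"
        using injD[OF \<open>inj ?N\<close>] that by blast
      then have "0 < (?N x - ?N y) \<bullet> (?N x - ?N y)" by simp
      \<comment> \<open>With \<open>JN\<close> this is the firm nonexpansiveness of Id - J, so
        injectivity suffices for a positive product.\<close>
      moreover have "(x - y) \<bullet> (?N x - ?N y)
          = (?J x - ?J y) \<bullet> (?N x - ?N y) + (?N x - ?N y) \<bullet> (?N x - ?N y)"
        by (subst split[of x y]) (rule inner_add_left)
      ultimately show ?thesis using JN[of x y] by linarith
    qed
    then show ?thesis by (simp add: strictly_monotone_op_def op_graph_def)
  qed
  have vi_v: "inj ?N" if asm: "strictly_monotone_op (\<lambda>x. {?N x})"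
  proof (rule injI, rule ccontr)
    fix x y assume "?N x = ?N y" "x \<noteq> y"
    moreover have "0 < (x - y) \<bullet> (?N x - ?N y)"
      using asm \<open>x \<noteq> y\<close> by (simp add: strictly_monotone_op_def op_graph_def)
    ultimately show False by simp
  qed
  \<comment> \<open>The implications form the cycles (i), (ii), (iii) and (iii), (iv), (v), joined
    by the equivalence of (v) and (vi).\<close>
  show ?thesis using i_ii ii_iii iii_i iii_iv iv_v v_iii v_vi vi_v by blast
qed

end
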